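(* For every $k\geq 2$, $\mathsf{TT}^1_k \not\leq_{\mathrm{W}} \mathsf{RT}^1_{\mathbb{N}}$.
   Context: A problem is a partial multivalued function from $\omega^\omega$ to $\omega^\omega$ with nonempty solution sets on its domain (its instances); objects are coded in $\omega^\omega$ via standard codings. $\mathsf{P} \leq_{\mathrm{W}} \mathsf{Q}$ means there are Turing functionals $\Phi,\Psi$ such that for every instance $x$ of $\mathsf{P}$, $\Phi(x)$ is an instance of $\mathsf{Q}$, and for every $\mathsf{Q}$-solution $y$ of $\Phi(x)$, $\Psi(x\oplus y)$ is a $\mathsf{P}$-solution of $x$. $\mathsf{RT}^1_{\mathbb{N}}$: instances are all $g:\omega\to\omega$ with finite range (i.e. $g:\omega\to j$ for some $j\geq1$, with no bound supplied), solutions all infinite $M\subseteq\omega$ on which $g$ is constant. $\mathsf{TT}^1_k$: instances are all $f:2^{<\omega}\to k$, solutions all $H\subseteq 2^{<\omega}$ with $(H,\preceq)$ order-isomorphic to $(2^{<\omega},\preceq)$ ($\preceq$ the prefix order) and $f$ constant on $H$. *)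

theory Defs
  imports "HOL-Library.Sublist"
begin

text \<open>
  Turing functionals are presented as the functions that are partial recursive relative
  to an oracle \<open>x :: nat \<Rightarrow> nat\<close>: programs are built from the usual basic functions
  and the oracle by composition, primitive recursion and minimisation;
  \<open>run x e as v\<close> says that \<open>e\<close> with oracle \<open>x\<close> halts on the argument list \<open>as\<close> with
  output \<open>v\<close>. Programs carry no arity: a program diverges on argument lists whose
  length does not fit it.
\<close>

type_synonym baire = "nat \<Rightarrow> nat"

datatype prog =
    Zero
  | Succ
  | Proj nat
  | Oracle
  | Comp prog "prog list"
  | Prec prog prog
  | Mu prog

inductive run :: "baire \<Rightarrow> prog \<Rightarrow> nat list \<Rightarrow> nat \<Rightarrow> bool" for x :: baire where
  run_Zero: "run x Zero as 0"
| run_Succ: "run x Succ [n] (Suc n)"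
| run_Proj: "i < length as \<Longrightarrow> run x (Proj i) as (as ! i)"
| run_Oracle: "run x Oracle [n] (x n)"
| run_Comp: "length bs = length gs \<Longrightarrow> (\<And>i. i < length gs \<Longrightarrow> run x (gs ! i) as (bs ! i))
    \<Longrightarrow> run x h bs c \<Longrightarrow> run x (Comp h gs) as c"
| run_Prec_0: "run x g as c \<Longrightarrow> run x (Prec g h) (0 # as) c"
| run_Prec_Suc: "run x (Prec g h) (n # as) b \<Longrightarrow> run x h (n # b # as) c
    \<Longrightarrow> run x (Prec g h) (Suc n # as) c"
| run_Mu: "run x f (n # as) 0 \<Longrightarrow> (\<And>m. m < n \<Longrightarrow> \<exists>b. run x f (m # as) (Suc b))
    \<Longrightarrow> run x (Mu f) as n"

inductive_cases basic_runE:
  "run x Zero as v" "run x Succ as v" "run x (Proj i) as v" "run x Oracle as v"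
  "run x (Prec g h) (0 # as) v"

lemma run_deterministic: "run x e as v \<Longrightarrow> run x e as w \<Longrightarrow> v = w"
proof (induction arbitrary: w rule: run.induct)
  case (run_Comp bs gs as h c)
  from run_Comp.prems obtain bs' where bs': "length bs' = length gs"
    "\<And>i. i < length gs \<Longrightarrow> run x (gs ! i) as (bs' ! i)" "run x h bs' w"
    by cases auto
  have "bs = bs'"
    using run_Comp.hyps run_Comp.IH bs' by (intro nth_equalityI) auto
  with bs' run_Comp.IH show ?case by auto
next
  case (run_Prec_Suc g h n as b c)
  from run_Prec_Suc.prems obtain b' where "run x (Prec g h) (n # as) b'" "run x h (n # b' # as) w"
    by cases auto
  with run_Prec_Suc.IH show ?case by blast
next
  case (run_Mu f n as)
  from run_Mu.prems have w: "run x f (w # as) 0"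
    "\<And>m. m < w \<Longrightarrow> \<exists>b. run x f (m # as) (Suc b)"
    by (cases; auto)+
  show ?case
  proof (rule linorder_cases[of n w])
    assume "n < w"
    with w(2) run_Mu.IH(1) show ?thesis by fastforce
  next
    assume "w < n"
    with w(1) run_Mu.IH(2) show ?thesis by fastforce
  qed
qed (blast elim: basic_runE)+

text \<open>
  A Turing functional is a partial map on Baire space, defined at \<open>x\<close> exactly when its
  program with oracle \<open>x\<close> halts on every input.
\<close>

definition turing_functional :: "(baire \<Rightarrow> baire option) \<Rightarrow> bool" where
  "turing_functional F \<longleftrightarrow> (\<exists>e. \<forall>x y. F x = Some y \<longleftrightarrow> (\<forall>n. run x e [n] (y n)))"

lemma ex_turing_functional: "\<exists>F. \<forall>x y. F x = Some y \<longleftrightarrow> (\<forall>n. run x e [n] (y n))"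
proof -
  let ?F = "\<lambda>x. if \<exists>y. \<forall>n. run x e [n] (y n) then Some (SOME y. \<forall>n. run x e [n] (y n)) else None"
  have "?F x = Some y \<longleftrightarrow> (\<forall>n. run x e [n] (y n))" for x y
  proof
    assume "?F x = Some y"
    then have ex: "\<exists>y. \<forall>n. run x e [n] (y n)"
      by (metis option.distinct(1))
    with \<open>?F x = Some y\<close> have "y = (SOME y. \<forall>n. run x e [n] (y n))"
      by simp
    with ex show "\<forall>n. run x e [n] (y n)"
      using someI_ex[of "\<lambda>y. \<forall>n. run x e [n] (y n)"] by simp
  next
    assume y: "\<forall>n. run x e [n] (y n)"
    then have "(SOME y. \<forall>n. run x e [n] (y n)) = y"
      by (intro some_equality ext) (use run_deterministic in blast)+
    with y show "?F x = Some y" by auto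
  qed
  then show ?thesis by (intro exI[of _ ?F]) blast
qed

definition join :: "baire \<Rightarrow> baire \<Rightarrow> baire" (infixl "\<oplus>" 65) where
  "(x \<oplus> y) n = (if even n then x (n div 2) else y (n div 2))"

definition char_fun :: "nat set \<Rightarrow> baire" where
  "char_fun A n = (if n \<in> A then 1 else 0)"

record problem =
  instances :: "baire set"
  solutions :: "baire \<Rightarrow> baire set"

definition is_problem :: "problem \<Rightarrow> bool" where
  "is_problem P \<longleftrightarrow> (\<forall>x\<in>instances P. solutions P x \<noteq> {})"

definition weihrauch_le :: "problem \<Rightarrow> problem \<Rightarrow> bool" (infix "\<le>\<^sub>W" 50) where
  "P \<le>\<^sub>W Q \<longleftrightarrow> (\<exists>\<Phi> \<Psi>. turing_functional \<Phi> \<and> turing_functional \<Psi> \<and>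
     (\<forall>x\<in>instances P. \<exists>z\<in>instances Q. \<Phi> x = Some z \<and>
        (\<forall>y\<in>solutions Q z. \<exists>w\<in>solutions P x. \<Psi> (x \<oplus> y) = Some w)))"

definition RT1_N :: problem where
  "RT1_N = \<lparr> instances = {g. finite (range g)},
             solutions = (\<lambda>g. {char_fun M | M. infinite M \<and> (\<exists>c. \<forall>m\<in>M. g m = c)}) \<rparr>"

text \<open>
  Finite binary strings are coded by their position in the length-lexicographic order.
\<close>

definition str_code :: "bool list \<Rightarrow> nat" where
  "str_code \<sigma> = foldl (\<lambda>n b. 2 * n + (if b then 2 else 1)) 0 \<sigma>"

lemma str_code_snoc: "str_code (\<sigma> @ [b]) = 2 * str_code \<sigma> + (if b then 2 else 1)"
  by (simp add: str_code_def)

lemma bij_str_code: "bij str_code"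
proof -
  have nil: "str_code [] = 0" by (simp add: str_code_def)
  have "str_code \<sigma> = str_code \<tau> \<Longrightarrow> \<sigma> = \<tau>" for \<sigma> \<tau>
  proof (induction \<sigma> arbitrary: \<tau> rule: rev_induct)
    case Nil
    then show ?case
      by (cases \<tau> rule: rev_cases) (auto simp: nil str_code_snoc split: if_splits)
  next
    case (snoc b \<sigma>)
    from snoc.prems obtain \<tau>' b' where \<tau>: "\<tau> = \<tau>' @ [b']"
      by (cases \<tau> rule: rev_cases) (auto simp: nil str_code_snoc split: if_splits)
    with snoc.prems have "b = b' \<and> str_code \<sigma> = str_code \<tau>'"
      unfolding \<tau> str_code_snoc by (cases b; cases b'; simp; presburger)
    with snoc.IH \<tau> show ?case by simp
  qed
  moreover have "\<exists>\<sigma>. str_code \<sigma> = n" for n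
  proof (induction n rule: less_induct)
    case (less n)
    show ?case
    proof (cases "n = 0")
      case True
      with nil show ?thesis by blast
    next
      case False
      then have "(n - 1) div 2 < n" by simp
      with less obtain \<sigma> where \<sigma>: "str_code \<sigma> = (n - 1) div 2" by blast
      have "str_code (\<sigma> @ [even n]) = n"
        unfolding str_code_snoc \<sigma> using False by (cases "even n"; simp; presburger)
      then show ?thesis by blast
    qed
  qed
  ultimately show ?thesis by (simp add: bij_def inj_def surj_def) metis
qed

definition tree_copy :: "bool list set \<Rightarrow> bool" where
  "tree_copy H \<longleftrightarrow> (\<exists>h :: bool list \<Rightarrow> bool list. bij_betw h UNIV H \<and> (\<forall>\<sigma> \<tau>. prefix (h \<sigma>) (h \<tau>) \<longleftrightarrow> prefix \<sigma> \<tau>))"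

definition TT1 :: "nat \<Rightarrow> problem" where
  "TT1 k = \<lparr> instances = {f. \<forall>\<sigma>. f (str_code \<sigma>) < k},
             solutions = (\<lambda>f. {char_fun (str_code ` H) | H.
                tree_copy H \<and> (\<exists>c. \<forall>\<sigma>\<in>H. f (str_code \<sigma>) = c)}) \<rparr>"

lemma is_problem_RT1_N: "is_problem RT1_N"
  unfolding is_problem_def
proof
  fix g assume "g \<in> instances RT1_N"
  then have "finite (range g)" by (simp add: RT1_N_def)
  then obtain c where "infinite (g -` {c})"
    using inf_img_fin_dom[of g UNIV] by (auto simp: vimage_def)
  then have "char_fun (g -` {c}) \<in> solutions RT1_N g"
    by (auto simp: RT1_N_def)
  then show "solutions RT1_N g \<noteq> {}" by blast
qed

lemma is_problem_TT1: "is_problem (TT1 k)"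
  unfolding is_problem_def
proof
  fix f assume f: "f \<in> instances (TT1 k)"
  define col where "col \<sigma> = f (str_code \<sigma>)" for \<sigma>
  have bound: "col \<sigma> < k" for \<sigma> using f by (simp add: TT1_def col_def)
  have "\<exists>c \<sigma>. \<forall>\<tau>. prefix \<sigma> \<tau> \<longrightarrow> (\<exists>\<rho>. prefix \<tau> \<rho> \<and> col \<rho> = c)"
  proof (rule ccontr)
    assume no: "\<not> ?thesis"
    have "\<exists>\<sigma>. \<forall>\<rho>. prefix \<sigma> \<rho> \<longrightarrow> col \<rho> \<ge> c" for c
    proof (induction c)
      case (Suc c)
      then obtain \<sigma> where \<sigma>: "\<And>\<rho>. prefix \<sigma> \<rho> \<Longrightarrow> col \<rho> \<ge> c" by blast
      from no obtain \<tau> where \<tau>: "prefix \<sigma> \<tau>" "\<And>\<rho>. prefix \<tau> \<rho> \<Longrightarrow> col \<rho> \<noteq> c" by blast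
      have "col \<rho> \<ge> Suc c" if "prefix \<tau> \<rho>" for \<rho>
        using \<sigma>[of \<rho>] \<tau>(2)[OF that] prefix_order.trans[OF \<tau>(1) that] by fastforce
      then show ?case by blast
    qed simp
    then obtain \<sigma> where "\<forall>\<rho>. prefix \<sigma> \<rho> \<longrightarrow> col \<rho> \<ge> k" by blast
    with bound[of \<sigma>] show False by (auto simp: not_less[symmetric])
  qed
  then obtain c \<sigma>0 where "\<forall>\<tau>. \<exists>\<rho>. prefix \<sigma>0 \<tau> \<longrightarrow> prefix \<tau> \<rho> \<and> col \<rho> = c" by blast
  then obtain p where p: "\<And>\<tau>. prefix \<sigma>0 \<tau> \<Longrightarrow> prefix \<tau> (p \<tau>)"
    "\<And>\<tau>. prefix \<sigma>0 \<tau> \<Longrightarrow> col (p \<tau>) = c" by metis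
  define h where "h = foldl (\<lambda>\<rho> b. p (\<rho> @ [b])) (p \<sigma>0)"
  have nil: "h [] = p \<sigma>0" and snoc: "h (\<tau> @ [b]) = p (h \<tau> @ [b])" for \<tau> b
    by (simp_all add: h_def)
  have above: "prefix \<sigma>0 (h \<tau>)" for \<tau>
  proof (induction \<tau> rule: rev_induct)
    case Nil
    show ?case using p(1)[of \<sigma>0] by (simp add: nil)
  next
    case (snoc b \<tau>)
    then have "prefix \<sigma>0 (h \<tau> @ [b])" by simp
    with p(1) show ?case unfolding \<open>\<And>\<tau> b. h (\<tau> @ [b]) = p (h \<tau> @ [b])\<close>
      using prefix_order.trans by blast
  qed
  have step: "prefix (h \<tau> @ [b]) (h (\<tau> @ [b]))" for \<tau> b
    unfolding snoc using above by (intro p(1)) simp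
  have col: "col (h \<tau>) = c" for \<tau>
    by (cases \<tau> rule: rev_cases) (simp_all add: nil snoc p(2) above)
  have mono: "prefix (h \<tau>) (h (\<tau> @ \<rho>))" for \<tau> \<rho>
  proof (induction \<rho> rule: rev_induct)
    case (snoc b \<rho>)
    with step[of "\<tau> @ \<rho>" b] show ?case
      by (metis append.assoc append_prefixD prefix_order.trans)
  qed simp
  have step': "prefix (h \<tau> @ [b]) (h (\<tau> @ b # \<rho>))" for \<tau> b \<rho>
    using prefix_order.trans[OF step mono[of "\<tau> @ [b]" \<rho>]] by simp
  have iff: "prefix (h \<sigma>) (h \<tau>) \<longleftrightarrow> prefix \<sigma> \<tau>" for \<sigma> \<tau>
  proof
    assume "prefix \<sigma> \<tau>"
    then show "prefix (h \<sigma>) (h \<tau>)" by (auto simp: prefix_def[of \<sigma> \<tau>] mono)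
  next
    assume le: "prefix (h \<sigma>) (h \<tau>)"
    show "prefix \<sigma> \<tau>"
    proof (rule ccontr)
      assume n: "\<not> prefix \<sigma> \<tau>"
      show False
      proof (cases "prefix \<tau> \<sigma>")
        case True
        with n obtain b \<rho> where "\<sigma> = \<tau> @ b # \<rho>"
          by (metis append_Nil2 neq_Nil_conv prefix_def prefix_order.refl)
        then have "prefix (h \<tau> @ [b]) (h \<tau>)"
          using step' le prefix_order.trans by blast
        then show False by (auto dest: prefix_length_le)
      next
        case False
        with n have "\<sigma> \<parallel> \<tau>" by auto
        then obtain as b bs b' bs' where d: "b \<noteq> b'" "\<sigma> = as @ b # bs" "\<tau> = as @ b' # bs'"
          using parallel_decomp[OF \<open>\<sigma> \<parallel> \<tau>\<close>] by metis
        then have "prefix (h as @ [b]) (h \<tau>)" "prefix (h as @ [b']) (h \<tau>)"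
          using step' le prefix_order.trans by blast+
        with d(1) show False by (auto simp: prefix_def)
      qed
    qed
  qed
  have "inj h" by (rule injI) (metis iff prefix_order.eq_iff)
  then have "tree_copy (range h)"
    unfolding tree_copy_def using iff by (auto intro!: exI[of _ h] simp: bij_betw_def)
  moreover have "\<forall>\<sigma>\<in>range h. f (str_code \<sigma>) = c" using col by (auto simp: col_def)
  ultimately have "char_fun (str_code ` range h) \<in> solutions (TT1 k) f"
    unfolding TT1_def by auto
  then show "solutions (TT1 k) f \<noteq> {}" by blast
qed

end

theory Submission
  imports Defs
begin

text \<open>
  The reduction fails already for continuity reasons. Given a reduction, the Baire category theorem
  provides a finite condition on the colouring \<open>f\<close> that bounds the range of the associated
  instance \<open>g\<close> by some \<open>j\<close>. For each of the \<open>j\<close> colours in turn, strengthen the condition so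
  that either the colour occurs only finitely often in \<open>g\<close>, or finitely many of its occurrences
  already force an antichain of size \<open>j\<close> into the solution computed back from it. One can pick a
  node from each of these antichains so that the chosen nodes are pairwise incomparable, and then
  colour the cone above each chosen node, outside the finite condition, differently from that node.
  Some colour occurs infinitely often in \<open>g\<close>, and a homogeneous set for it that begins with
  the forced occurrences is sent to a set that cannot be a monochromatic copy of the tree.
\<close>

section \<open>Continuity of Turing functionals\<close>

abbreviation agree :: "nat \<Rightarrow> baire \<Rightarrow> baire \<Rightarrow> bool" where
  "agree n x y \<equiv> \<forall>i<n. x i = y i"

text \<open>The use principle: a halting computation consults its oracle only finitely often.
  Composition and minimisation involve finitely many subcomputations, and the sum of their uses
  dominates each of them.\<close>

lemma run_use:
  assumes "run x e as v"
  shows "\<exists>n. \<forall>x'. agree n x x' \<longrightarrow> run x' e as v"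
  using assms
proof (induction rule: run.induct)
  case (run_Oracle m)
  have "run x' Oracle [m] (x m)" if "agree (Suc m) x x'" for x'
    using run.run_Oracle[of x' m] that by simp
  then show ?case by blast
next
  case (run_Comp bs gs as h c)
  then obtain u where u: "\<And>i x'. i < length gs \<Longrightarrow> agree (u i) x x' \<Longrightarrow> run x' (gs ! i) as (bs ! i)"
    by metis
  from run_Comp obtain n where n: "\<And>x'. agree n x x' \<Longrightarrow> run x' h bs c" by blast
  define N where "N = n + sum u {..<length gs}"
  have "u i \<le> N" if "i < length gs" for i
    using member_le_sum[of i "{..<length gs}" u] that by (simp add: N_def)
  moreover have "n \<le> N" by (simp add: N_def)
  ultimately have "run x' (Comp h gs) as c" if "agree N x x'" for x'
    using run_Comp.hyps(1) u n that by (intro run.run_Comp[of bs gs]) (auto simp: order.strict_trans2)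
  then show ?case by blast
next
  case (run_Prec_Suc g h n as b c)
  then obtain p q where "\<And>x'. agree p x x' \<Longrightarrow> run x' (Prec g h) (n # as) b"
    "\<And>x'. agree q x x' \<Longrightarrow> run x' h (n # b # as) c" by blast
  then have "run x' (Prec g h) (Suc n # as) c" if "agree (p + q) x x'" for x'
    using that by (intro run.run_Prec_Suc[of x' g h n as b]) auto
  then show ?case by blast
next
  case (run_Mu f n as)
  then obtain b u where u: "\<And>m x'. m < n \<Longrightarrow> agree (u m) x x' \<Longrightarrow> run x' f (m # as) (Suc (b m))"
    by metis
  from run_Mu obtain p where p: "\<And>x'. agree p x x' \<Longrightarrow> run x' f (n # as) 0" by blast
  define N where "N = p + sum u {..<n}"
  have "u m \<le> N" if "m < n" for m
    using member_le_sum[of m "{..<n}" u] that by (simp add: N_def)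
  moreover have "p \<le> N" by (simp add: N_def)
  ultimately have "run x' (Mu f) as n" if "agree N x x'" for x'
    using u p that by (intro run.run_Mu) (auto simp: order.strict_trans2)
  then show ?case by blast
qed (blast intro: run.intros)+

text \<open>The first \<open>m\<close> outputs have finite uses, which are added up. Below this
  bound \<open>x'\<close> yields the same outputs, and determinism identifies them with those of
  \<open>y'\<close>.\<close>

lemma turing_functional_continuous:
  assumes "turing_functional F" "F x = Some y"
  shows "\<exists>n. \<forall>x' y'. agree n x x' \<longrightarrow> F x' = Some y' \<longrightarrow> agree m y y'"
proof -
  from assms(1) obtain e where e: "\<And>x y. F x = Some y \<longleftrightarrow> (\<forall>n. run x e [n] (y n))"
    unfolding turing_functional_def by blast
  then have "\<forall>i. \<exists>n. \<forall>x'. agree n x x' \<longrightarrow> run x' e [i] (y i)"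
    using assms(2) run_use by blast
  then obtain u where u: "\<And>i x'. agree (u i) x x' \<Longrightarrow> run x' e [i] (y i)"
    by metis
  have "agree m y y'" if "agree (sum u {..<m}) x x'" "F x' = Some y'" for x' y'
  proof (intro allI impI)
    fix i assume "i < m"
    then have "u i \<le> sum u {..<m}" using member_le_sum[of i "{..<m}" u] by simp
    then have "run x' e [i] (y i)" using that(1) u by simp
    moreover have "run x' e [i] (y' i)" using that(2) e by blast
    ultimately show "y i = y' i" by (rule run_deterministic)
  qed
  then show ?thesis by blast
qed

text \<open>Position \<open>i\<close> of a join reads position \<open>i div 2 \<le> i\<close> of one
  of its halves.\<close>

lemma agree_join:
  assumes "agree n x x'" "agree n y y'"
  shows "agree n (x \<oplus> y) (x' \<oplus> y')"
  using assms by (simp add: join_def)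

section \<open>Antichains and copies of the binary tree\<close>

definition antichain :: "bool list set \<Rightarrow> bool" where
  "antichain A \<longleftrightarrow> (\<forall>a\<in>A. \<forall>b\<in>A. prefix a b \<longrightarrow> a = b)"

text \<open>The strings consisting of \<open>i\<close> times \<open>True\<close> and one
  \<open>False\<close> are pairwise incomparable, and an embedding of the tree keeps them
  so.\<close>

lemma tree_copy_antichain:
  assumes "tree_copy H"
  shows "\<exists>A\<subseteq>H. finite A \<and> card A = j \<and> antichain A"
proof -
  obtain h :: "bool list \<Rightarrow> bool list" where h: "bij_betw h UNIV H" "\<And>\<sigma> \<tau>. prefix (h \<sigma>) (h \<tau>) \<longleftrightarrow> prefix \<sigma> \<tau>"
    using assms unfolding tree_copy_def by blast
  define s where "s i = replicate i True @ [False]" for i :: nat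
  have s: "i = i'" if pre: "prefix (s i) (s i')" for i i'
  proof (rule ccontr)
    assume "i \<noteq> i'"
    have "length (s i) \<le> length (s i')" using pre by (rule prefix_length_le)
    then have "i < i'" using \<open>i \<noteq> i'\<close> by (simp add: s_def)
    then have "s i' ! i" by (simp add: s_def nth_append)
    moreover obtain zs where "s i' = s i @ zs" using pre unfolding prefix_def by blast
    then have "\<not> s i' ! i" by (simp add: s_def nth_append)
    ultimately show False by contradiction
  qed
  have "inj s" using s by (metis injI prefix_order.refl)
  moreover have "inj h" "range h = H" using h(1) by (auto simp: bij_betw_def)
  ultimately have "inj_on (h \<circ> s) {..<j}" by (meson inj_compose inj_on_subset subset_UNIV)
  then have "card ((h \<circ> s) ` {..<j}) = j" using card_image by force
  moreover have "antichain ((h \<circ> s) ` {..<j})"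
    using s h(2) by (auto simp: antichain_def)
  moreover have "(h \<circ> s) ` {..<j} \<subseteq> H" using \<open>range h = H\<close> by auto
  ultimately show ?thesis by blast
qed

text \<open>If \<open>a\<close> is the image of \<open>\<tau>\<close>, the images of the extensions
  of \<open>\<tau>\<close> by blocks of \<open>True\<close> are distinct nodes above
  \<open>a\<close>.\<close>

lemma tree_copy_infinite_above:
  assumes "tree_copy H" "a \<in> H"
  shows "infinite {b \<in> H. prefix a b}"
proof -
  obtain h :: "bool list \<Rightarrow> bool list" where h: "bij_betw h UNIV H" "\<And>\<sigma> \<tau>. prefix (h \<sigma>) (h \<tau>) \<longleftrightarrow> prefix \<sigma> \<tau>"
    using assms(1) unfolding tree_copy_def by blast
  have hr: "inj h" "range h = H" using h(1) by (auto simp: bij_betw_def)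
  then obtain \<tau> where \<tau>: "a = h \<tau>" using assms(2) by blast
  define t where "t i = h (\<tau> @ replicate i True)" for i :: nat
  have "i = i'" if "t i = t i'" for i i'
  proof -
    have "\<tau> @ replicate i True = \<tau> @ replicate i' True"
      using that hr(1) unfolding t_def by (rule injD[rotated])
    then show ?thesis by (metis same_append_eq length_replicate)
  qed
  then have "inj t" by (rule injI)
  then have "infinite (range t)" by (simp add: finite_image_iff)
  moreover have "range t \<subseteq> {b \<in> H. prefix a b}"
    using hr by (auto simp: t_def \<tau> h(2))
  ultimately show ?thesis using finite_subset by blast
qed

text \<open>
  A longest node among all the antichains is comparable only with its own prefixes, of which every
  antichain contains at most one; so it can be chosen and discarded together with those prefixes.
\<close>

lemma incomparable_representatives:
  assumes "finite I"
    and "\<And>i. i \<in> I \<Longrightarrow> finite (A i)" "\<And>i. i \<in> I \<Longrightarrow> antichain (A i)"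
    and "\<And>i. i \<in> I \<Longrightarrow> card (A i) \<ge> card I"
  shows "\<exists>r. (\<forall>i\<in>I. r i \<in> A i) \<and> (\<forall>i\<in>I. \<forall>i'\<in>I. i \<noteq> i' \<longrightarrow> \<not> prefix (r i) (r i'))"
  using assms
proof (induction "card I" arbitrary: I A)
  case 0
  then show ?case by simp
next
  case (Suc n)
  define U where "U = (\<Union>i\<in>I. A i)"
  have "I \<noteq> {}" using Suc.hyps(2) by auto
  then obtain i1 where "i1 \<in> I" by blast
  then have "A i1 \<noteq> {}" using Suc.prems(4)[of i1] Suc.hyps(2) by auto
  then have "U \<noteq> {}" "finite U" using Suc.prems \<open>i1 \<in> I\<close> by (auto simp: U_def)
  moreover from this have "Max (length ` U) \<in> length ` U" by (intro Max_in) auto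
  ultimately obtain a where a: "a \<in> U" "\<And>b. b \<in> U \<Longrightarrow> length b \<le> length a"
    by (metis (no_types, lifting) Max_ge finite_imageI image_eqI imageE)
  then obtain i0 where i0: "i0 \<in> I" "a \<in> A i0" by (auto simp: U_def)
  define B where "B i = {b \<in> A i. \<not> prefix b a}" for i
  let ?J = "I - {i0}"
  have J: "card ?J = n" using Suc.hyps(2) i0 Suc.prems(1) by simp
  have "card (B i) \<ge> n" if "i \<in> I" for i
  proof -
    have "\<exists>c. A i - B i \<subseteq> {c}"
    proof (cases "\<exists>c. c \<in> A i - B i")
      case True
      then obtain c where c: "c \<in> A i" "prefix c a" by (auto simp: B_def)
      have "b = c" if "b \<in> A i - B i" for b
      proof -
        have "b \<in> A i" "prefix b a" using that by (auto simp: B_def)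
        then have "prefix b c \<or> prefix c b" using c prefix_same_cases by blast
        then show ?thesis using Suc.prems(3)[OF \<open>i \<in> I\<close>] c \<open>b \<in> A i\<close>
          unfolding antichain_def by metis
      qed
      then show ?thesis by blast
    qed blast
    then obtain c where "A i \<subseteq> insert c (B i)" by blast
    moreover have "finite (B i)" using Suc.prems(2)[OF that] by (simp add: B_def)
    ultimately have "card (A i) \<le> card (insert c (B i))" by (intro card_mono) auto
    also have "\<dots> \<le> Suc (card (B i))" using \<open>finite (B i)\<close> by (simp add: card_insert_if)
    finally show ?thesis using Suc.prems(4)[OF that] Suc.hyps(2) by simp
  qed
  moreover have "finite (B i)" "antichain (B i)" if "i \<in> I" for i
    using Suc.prems(2,3)[OF that] by (auto simp: B_def antichain_def)
  ultimately obtain r where r: "\<forall>i\<in>?J. r i \<in> B i"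
    "\<forall>i\<in>?J. \<forall>i'\<in>?J. i \<noteq> i' \<longrightarrow> \<not> prefix (r i) (r i')"
    using Suc.hyps(1)[of ?J B] J Suc.prems(1) by auto
  have no_ext: "\<not> prefix a b" if "b \<in> B i" "i \<in> I" for b i
  proof
    assume "prefix a b"
    moreover have "length b \<le> length a" using that a(2) by (auto simp: B_def U_def)
    ultimately have "a = b" by (auto simp: prefix_def)
    then show False using that(1) by (simp add: B_def)
  qed
  have "\<not> prefix (r i) a" "\<not> prefix a (r i)" if "i \<in> ?J" for i
    using r(1) that no_ext[of "r i" i] by (auto simp: B_def)
  then show ?case
    using r i0 by (intro exI[of _ "r(i0 := a)"]) (auto simp: B_def)
qed

lemma str_code_infinite_image: "infinite S \<Longrightarrow> infinite (str_code ` S)"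
  using bij_str_code finite_imageD[of str_code S] by (auto simp: bij_def inj_on_def)

section \<open>Reductions as continuous maps\<close>

text \<open>The topological content of a reduction: \<open>G\<close> is the forward map and
  \<open>S f M\<close> the tree decoded from the answer to \<open>M\<close>. Continuity of
  \<open>S\<close> speaks of positive membership, since the argument forces nodes into
  solutions.\<close>

locale continuous_reduction =
  fixes k :: nat and G :: "baire \<Rightarrow> baire" and S :: "baire \<Rightarrow> nat set \<Rightarrow> bool list set"
    and X :: "baire set" and hom :: "baire \<Rightarrow> nat set \<Rightarrow> bool"
  defines "X \<equiv> {f. \<forall>n. f n < k}"
    and "hom f M \<equiv> infinite M \<and> (\<exists>c. \<forall>m\<in>M. G f m = c)"
  assumes two_le: "2 \<le> k"
    and finite_range: "f \<in> X \<Longrightarrow> finite (range (G f))"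
    and G_continuous: "f \<in> X \<Longrightarrow> \<exists>n. \<forall>f'\<in>X. agree n f f' \<longrightarrow> agree m (G f) (G f')"
    and S_tree_copy: "f \<in> X \<Longrightarrow> hom f M \<Longrightarrow> tree_copy (S f M)"
    and S_monochromatic: "f \<in> X \<Longrightarrow> hom f M \<Longrightarrow> \<exists>c. \<forall>\<sigma>\<in>S f M. f (str_code \<sigma>) = c"
    and S_continuous: "f \<in> X \<Longrightarrow> hom f M \<Longrightarrow> \<sigma> \<in> S f M \<Longrightarrow>
      \<exists>n. \<forall>f'\<in>X. \<forall>M'. agree n f f' \<longrightarrow> hom f' M' \<longrightarrow> M \<inter> {..<n} = M' \<inter> {..<n} \<longrightarrow> \<sigma> \<in> S f' M'"
begin

text \<open>Baire category: if no cylinder bounded the range, each could be shrunk to one that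
  forces a value at least \<open>j\<close>. Doing so for every \<open>j\<close> gives a limit
  colouring \<open>f\<close> with \<open>G f\<close> unbounded, against
  \<open>finite_range\<close>.\<close>

lemma bounded_range: "\<exists>f\<in>X. \<exists>n j. \<forall>f'\<in>X. agree n f f' \<longrightarrow> (\<forall>m. G f' m < j)"
proof (rule ccontr)
  assume no: "\<not> ?thesis"
  have step: "\<exists>f'\<in>X. \<exists>n'>n. agree n f f' \<and> (\<forall>f''\<in>X. agree n' f' f'' \<longrightarrow> (\<exists>m. G f'' m \<ge> j))"
    if "f \<in> X" for f n j
  proof -
    have "\<exists>f'\<in>X. \<exists>m. agree n f f' \<and> \<not> G f' m < j" using no that by blast
    then obtain f' m where f': "f' \<in> X" "agree n f f'" "\<not> G f' m < j" by blast
    obtain n' where n': "\<And>f''. f'' \<in> X \<Longrightarrow> agree n' f' f'' \<Longrightarrow> agree (Suc m) (G f') (G f'')"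
      using G_continuous[OF f'(1), where m = "Suc m"] by blast
    \<comment> \<open>The part \<open>n'\<close> of the new length fixes the value at
      \<open>m\<close>; the part \<open>Suc n\<close> makes the condition strictly longer.\<close>
    have "G f'' m \<ge> j" if "f'' \<in> X" "agree (n' + Suc n) f' f''" for f''
      using n'[of f''] that f'(3) by simp
    then show ?thesis using f' by (intro bexI[of _ f'] exI[of _ "n' + Suc n"]) auto
  qed
  define P where "P = (\<lambda>(_::nat) (p :: baire \<times> nat). fst p \<in> X)"
  define Q where "Q = (\<lambda>j (p :: baire \<times> nat) p'. snd p < snd p' \<and> agree (snd p) (fst p) (fst p')
    \<and> (\<forall>f''\<in>X. agree (snd p') (fst p') f'' \<longrightarrow> (\<exists>m. G f'' m \<ge> j)))"
  have "\<exists>s. \<forall>j. P j (s j) \<and> Q j (s j) (s (Suc j))"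
  proof (rule dependent_nat_choice)
    show "\<exists>p. P 0 p" using two_le by (auto simp: P_def X_def intro!: exI[of _ "\<lambda>_. 0"])
  next
    fix p :: "baire \<times> nat" and j assume "P j p"
    then show "\<exists>p'. P (Suc j) p' \<and> Q j p p'"
      using step[of "fst p" "snd p" j] by (auto simp: P_def Q_def)
  qed
  then obtain s where s: "\<And>j. P j (s j)" "\<And>j. Q j (s j) (s (Suc j))" by blast
  define F N where "F j = fst (s j)" and "N j = snd (s j)" for j
  have F: "F j \<in> X" "N j < N (Suc j)" "agree (N j) (F j) (F (Suc j))"
    "\<And>f''. f'' \<in> X \<Longrightarrow> agree (N (Suc j)) (F (Suc j)) f'' \<Longrightarrow> \<exists>m. G f'' m \<ge> j" for j
    using s[of j] by (auto simp: P_def Q_def F_def N_def)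
  have "strict_mono N" using F(2) by (simp add: strict_mono_Suc_iff)
  then have N_ge: "j \<le> N j" and N_mono: "i \<le> j \<Longrightarrow> N i \<le> N j" for i j
    by (simp_all add: strict_mono_imp_increasing strict_mono_less_eq)
  have later: "agree (N j) (F j) (F (j + d))" for j d
  proof (induction d)
    case (Suc d)
    then show ?case using F(3)[of "j + d"] N_mono[of j "j + d"] by (auto simp: order.strict_trans2)
  qed simp
  \<comment> \<open>The diagonal limit: \<open>x < N (Suc x)\<close>, so the value at
    \<open>x\<close> no longer changes from stage \<open>Suc x\<close> on.\<close>
  define f where "f x = F (Suc x) x" for x
  have "f \<in> X" using F(1) by (auto simp: f_def X_def)
  have "agree (N j) (F j) f" for j
  proof (intro allI impI)
    fix x assume x: "x < N j"
    have "x < N (Suc x)" using N_ge[of "Suc x"] by simp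
    then show "F j x = f x"
      \<comment> \<open>The later of the stages \<open>j\<close> and \<open>Suc x\<close> agrees
        with the earlier at \<open>x\<close>; truncated subtraction makes the other instance
        trivial.\<close>
      using x later[of j "Suc x - j"] later[of "Suc x" "j - Suc x"]
      by (cases "j \<le> Suc x") (simp_all add: f_def)
  qed
  then have unbounded: "\<exists>m. G f m \<ge> j" for j using F(4) \<open>f \<in> X\<close> by blast
  obtain b where "\<And>m. G f m \<le> b"
    using finite_range[OF \<open>f \<in> X\<close>] finite_nat_set_iff_bounded_le by auto
  then show False using unbounded[of "Suc b"] by (metis not_less_eq_eq)
qed

section \<open>Settling the colours one by one\<close>

text \<open>A pair \<open>f\<close>, \<open>n\<close> serves as a finite condition: the cylinder of
  all colourings in \<open>X\<close> that agree with \<open>f\<close> below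
  \<open>n\<close>.\<close>

definition vanishes :: "baire \<Rightarrow> nat \<Rightarrow> nat \<Rightarrow> bool" where
  "vanishes f n i \<longleftrightarrow> (\<forall>f'\<in>X. agree n f f' \<longrightarrow> finite {m. G f' m = i})"

text \<open>The finite stem \<open>D \<inter> {..<u}\<close> starts a homogeneous set of colour
  \<open>i\<close>. Codes of \<open>A\<close> lie below \<open>n\<close> so that the condition
  already fixes the colours of these nodes.\<close>

definition forces :: "baire \<Rightarrow> nat \<Rightarrow> nat \<Rightarrow> nat set \<Rightarrow> nat \<Rightarrow> bool list set \<Rightarrow> bool" where
  "forces f n i D u A \<longleftrightarrow> str_code ` A \<subseteq> {..<n} \<and>
     (\<forall>f'\<in>X. agree n f f' \<longrightarrow> D \<inter> {..<u} \<subseteq> {m. G f' m = i} \<and>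
        (\<forall>M. hom f' M \<longrightarrow> M \<inter> {..<u} = D \<inter> {..<u} \<longrightarrow> A \<subseteq> S f' M))"

definition settled :: "nat \<Rightarrow> baire \<Rightarrow> nat \<Rightarrow> nat \<Rightarrow> bool" where
  "settled j f n i \<longleftrightarrow> vanishes f n i \<or>
     (\<exists>D u A. forces f n i D u A \<and> finite A \<and> card A = j \<and> antichain A)"

lemma settled_extend:
  assumes "settled j f n i" "agree n f f'" "n \<le> n'"
  shows "settled j f' n' i"
proof -
  have "agree n f f''" if "agree n' f' f''" for f''
    using that assms(2,3) by simp
  note agree = this
  have "vanishes f n i \<Longrightarrow> vanishes f' n' i"
    unfolding vanishes_def using agree by blast
  moreover have "forces f' n' i D u A" if "forces f n i D u A" for D u A
    unfolding forces_def
  proof (rule conjI)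
    have "str_code ` A \<subseteq> {..<n}" using that by (simp add: forces_def)
    then show "str_code ` A \<subseteq> {..<n'}" using assms(3) by auto
  qed (use that agree in \<open>unfold forces_def, blast\<close>)
  ultimately show ?thesis using assms(1) unfolding settled_def by blast
qed

text \<open>If colour \<open>i\<close> can still occur infinitely often, take a colouring where it
  does, its whole colour class as homogeneous set, and an antichain in the resulting tree. By
  continuity a finite part of these data already forces the antichain.\<close>

lemma settle:
  assumes "f \<in> X"
  shows "\<exists>f'\<in>X. \<exists>n'\<ge>n. agree n f f' \<and> settled j f' n' i"
proof (cases "vanishes f n i")
  case True
  then show ?thesis using assms by (auto simp: settled_def)
next
  case False
  then obtain f' where f': "f' \<in> X" "agree n f f'" "infinite {m. G f' m = i}"
    by (auto simp: vanishes_def)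
  define M where "M = {m. G f' m = i}"
  have M: "hom f' M" using f'(3) by (auto simp: hom_def M_def)
  obtain A where A: "A \<subseteq> S f' M" "finite A" "card A = j" "antichain A"
    using tree_copy_antichain[OF S_tree_copy[OF f'(1) M]] by blast
  have "\<forall>\<sigma>\<in>A. \<exists>u. \<forall>f''\<in>X. \<forall>M'. agree u f' f'' \<longrightarrow> hom f'' M' \<longrightarrow>
      M \<inter> {..<u} = M' \<inter> {..<u} \<longrightarrow> \<sigma> \<in> S f'' M'"
    using S_continuous[OF f'(1) M] A(1) by blast
  from bchoice[OF this] obtain u where u: "\<forall>\<sigma>\<in>A. \<forall>f''\<in>X. \<forall>M'. agree (u \<sigma>) f' f'' \<longrightarrow>
      hom f'' M' \<longrightarrow> M \<inter> {..<u \<sigma>} = M' \<inter> {..<u \<sigma>} \<longrightarrow> \<sigma> \<in> S f'' M'" by blast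
  define v where "v = sum u A"
  have uv: "u \<sigma> \<le> v" if "\<sigma> \<in> A" for \<sigma>
    using member_le_sum[of \<sigma> A u] that A(2) by (simp add: v_def)
  obtain p where p: "\<And>f''. f'' \<in> X \<Longrightarrow> agree p f' f'' \<Longrightarrow> agree v (G f') (G f'')"
    using G_continuous[OF f'(1), where m = v] by blast
  obtain q where q: "str_code ` A \<subseteq> {..<q}"
    using A(2) finite_nat_set_iff_bounded[of "str_code ` A"] by auto
  \<comment> \<open>Here \<open>n\<close> preserves the old condition, \<open>v\<close> covers the
    uses of the nodes in \<open>A\<close>, \<open>p\<close> fixes \<open>G\<close> on the stem, and
    \<open>q\<close> bounds the codes of \<open>A\<close>.\<close>
  define n' where "n' = n + v + p + q"
  have "forces f' n' i M v A"
    unfolding forces_def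
  proof (intro conjI ballI impI allI)
    show "str_code ` A \<subseteq> {..<n'}" using q by (fastforce simp: n'_def)
    fix f'' assume f'': "f'' \<in> X" "agree n' f' f''"
    have "agree p f' f''" using f''(2) by (simp add: n'_def)
    with p f''(1) have "agree v (G f') (G f'')" by blast
    then show "M \<inter> {..<v} \<subseteq> {m. G f'' m = i}" by (auto simp: M_def)
    fix M' assume M': "hom f'' M'" "M' \<inter> {..<v} = M \<inter> {..<v}"
    show "A \<subseteq> S f'' M'"
    proof
      fix \<sigma> assume \<sigma>: "\<sigma> \<in> A"
      have "{..<u \<sigma>} \<subseteq> {..<v}" using uv[OF \<sigma>] by simp
      then have "{..<v} \<inter> {..<u \<sigma>} = {..<u \<sigma>}" by (rule Int_absorb1)
      with M'(2) have "M \<inter> {..<u \<sigma>} = M' \<inter> {..<u \<sigma>}" by (metis Int_assoc)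
      moreover have "agree (u \<sigma>) f' f''"
        using f''(2) uv[OF \<sigma>] by (simp add: n'_def)
      ultimately show "\<sigma> \<in> S f'' M'" using u \<sigma> f''(1) M'(1) by blast
    qed
  qed
  then show ?thesis using f' A
    by (intro bexI[of _ f'] exI[of _ n']) (auto simp: settled_def n'_def)
qed

lemma settle_all:
  assumes "f \<in> X"
  shows "\<exists>f'\<in>X. \<exists>n'\<ge>n. agree n f f' \<and> (\<forall>i<l. settled j f' n' i)"
proof (induction l)
  case 0
  then show ?case using assms by auto
next
  case (Suc l)
  then obtain f1 n1 where 1: "f1 \<in> X" "n1 \<ge> n" "agree n f f1" "\<forall>i<l. settled j f1 n1 i" by blast
  obtain f2 n2 where 2: "f2 \<in> X" "n2 \<ge> n1" "agree n1 f1 f2" "settled j f2 n2 l"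
    using settle[OF 1(1)] by blast
  have "settled j f2 n2 i" if "i < Suc l" for i
    using that 1(4) 2 settled_extend[of j f1 n1 i f2 n2] by (auto simp: less_Suc_eq)
  moreover have "agree n f f2" "n \<le> n2" using 1(2,3) 2(2,3) by simp_all
  ultimately show ?case using 2(1) by blast
qed

section \<open>The colouring that defeats the reduction\<close>

lemma inconsistent: False
proof -
  obtain f0 n0 j where f0: "f0 \<in> X" and j: "\<And>f m. f \<in> X \<Longrightarrow> agree n0 f0 f \<Longrightarrow> G f m < j"
    using bounded_range by blast
  obtain f1 n where f1: "f1 \<in> X" "n \<ge> n0" "agree n0 f0 f1" "\<And>i. i < j \<Longrightarrow> settled j f1 n i"
    using settle_all[OF f0] by blast
  \<comment> \<open>The colours that may still occur infinitely often. There are at most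
    \<open>j\<close> of them, matching the size of the forced antichains.\<close>
  define I where "I = {i. i < j \<and> \<not> vanishes f1 n i}"
  have "\<forall>i\<in>I. \<exists>D u A. forces f1 n i D u A \<and> finite A \<and> card A = j \<and> antichain A"
    using f1(4) by (auto simp: I_def settled_def)
  then obtain D u A where A: "\<And>i. i \<in> I \<Longrightarrow> forces f1 n i (D i) (u i) (A i)"
      "\<And>i. i \<in> I \<Longrightarrow> finite (A i)" "\<And>i. i \<in> I \<Longrightarrow> card (A i) = j" "\<And>i. i \<in> I \<Longrightarrow> antichain (A i)"
    by metis
  have "I \<subseteq> {..<j}" by (auto simp: I_def)
  then have "finite I" "card I \<le> j"
    using finite_subset card_mono[of "{..<j}" I] by auto
  then have "\<exists>r. (\<forall>i\<in>I. r i \<in> A i) \<and> (\<forall>i\<in>I. \<forall>i'\<in>I. i \<noteq> i' \<longrightarrow> \<not> prefix (r i) (r i'))"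
    using A(2-4) by (intro incomparable_representatives) auto
  then obtain r where r: "\<And>i. i \<in> I \<Longrightarrow> r i \<in> A i"
      "\<And>i i'. i \<in> I \<Longrightarrow> i' \<in> I \<Longrightarrow> i \<noteq> i' \<Longrightarrow> \<not> prefix (r i) (r i')"
    by metis
  define cone where "cone i = {str_code b | b. prefix (r i) b}" for i
  have cone_disjoint: "i = i'" if i: "i \<in> I" "i' \<in> I" and x: "x \<in> cone i" "x \<in> cone i'" for i i' x
  proof -
    obtain b where "x = str_code b" "prefix (r i) b" using x(1) by (auto simp: cone_def)
    moreover obtain b' where "x = str_code b'" "prefix (r i') b'" using x(2) by (auto simp: cone_def)
    moreover have "b = b'" using calculation(1,3) bij_str_code by (metis bij_is_inj injD)
    ultimately have "prefix (r i) (r i') \<or> prefix (r i') (r i)" using prefix_same_cases by blast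
    then show ?thesis using r(2) i by blast
  qed
  define c where "c i = (if f1 (str_code (r i)) = 0 then 1 else 0 :: nat)" for i
  \<comment> \<open>Each \<open>r i\<close> has code below \<open>n\<close> and keeps its colour,
    while the rest of its cone from \<open>n\<close> on gets \<open>c i\<close>. The cones are
    disjoint, so \<open>THE\<close> is well defined; outside them 0 is just some colour below
    \<open>k\<close>.\<close>
  define f where "f x = (if x < n then f1 x
    else if \<exists>i\<in>I. x \<in> cone i then c (THE i. i \<in> I \<and> x \<in> cone i) else 0)" for x
  have f_cone: "f x = c i" if "i \<in> I" "x \<in> cone i" "x \<ge> n" for x i
  proof -
    have "(THE i. i \<in> I \<and> x \<in> cone i) = i"
      using that cone_disjoint by (intro the_equality) auto
    then show ?thesis using that by (auto simp: f_def)
  qed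
  have "c i < k" for i using two_le by (simp add: c_def)
  then have "f \<in> X" using f1(1) two_le by (auto simp: f_def X_def)
  have agree: "agree n f1 f" by (simp add: f_def)
  have "\<exists>i. infinite (G f -` {i})"
    using inf_img_fin_dom[OF finite_range[OF \<open>f \<in> X\<close>]] by auto
  then obtain i where i: "infinite {m. G f m = i}" by (auto simp: vimage_def)
  have "i < j"
  proof -
    obtain m where "G f m = i" using i by (metis (mono_tags, lifting) Collect_empty_eq finite.emptyI)
    then show ?thesis using j[OF \<open>f \<in> X\<close>, of m] f1(2,3) agree by auto
  qed
  then have "i \<in> I" using i \<open>f \<in> X\<close> agree by (auto simp: I_def vanishes_def)
  \<comment> \<open>Below \<open>u i\<close> exactly the stem is taken, as forcing demands; beyond
    it all occurrences of colour \<open>i\<close> make the set infinite.\<close>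
  define M where "M = D i \<inter> {..<u i} \<union> ({m. G f m = i} - {..<u i})"
  have forced: "D i \<inter> {..<u i} \<subseteq> {m. G f m = i}" "str_code ` A i \<subseteq> {..<n}"
      "\<And>M. hom f M \<Longrightarrow> M \<inter> {..<u i} = D i \<inter> {..<u i} \<Longrightarrow> A i \<subseteq> S f M"
    using A(1)[OF \<open>i \<in> I\<close>] \<open>f \<in> X\<close> agree by (auto simp: forces_def)
  have M: "hom f M" using i forced(1) by (auto simp: hom_def M_def)
  have "A i \<subseteq> S f M" using forced(3)[OF M] by (auto simp: M_def)
  then have ri: "r i \<in> S f M" "str_code (r i) < n" using r(1)[OF \<open>i \<in> I\<close>] forced(2) by auto
  \<comment> \<open>The copy has infinitely many nodes above \<open>r i\<close>, and only finitely
    many have codes below \<open>n\<close>; so it meets the recoloured part of the cone.\<close>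
  have "infinite (str_code ` {b \<in> S f M. prefix (r i) b})"
    using tree_copy_infinite_above[OF S_tree_copy[OF \<open>f \<in> X\<close> M] ri(1)] by (rule str_code_infinite_image)
  then have "\<not> str_code ` {b \<in> S f M. prefix (r i) b} \<subseteq> {..<n}" using finite_subset by blast
  then obtain b where b: "b \<in> S f M" "prefix (r i) b" "str_code b \<ge> n"
    by (auto simp: image_subset_iff not_less)
  then have "f (str_code b) = c i" using f_cone[OF \<open>i \<in> I\<close>] by (auto simp: cone_def)
  moreover have "f (str_code (r i)) \<noteq> c i" using ri(2) by (simp add: f_def c_def)
  moreover have "f (str_code b) = f (str_code (r i))"
    using S_monochromatic[OF \<open>f \<in> X\<close> M] b(1) ri(1) by metis
  ultimately show False by simp
qed

end

section \<open>From a Weihrauch reduction to continuous maps\<close>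

theorem theorem4p7:
  fixes k :: nat
  assumes "k \<ge> 2"
  shows "\<not> TT1 k \<le>\<^sub>W RT1_N"
proof
  assume "TT1 k \<le>\<^sub>W RT1_N"
  then obtain \<Phi> \<Psi> where tf: "turing_functional \<Phi>" "turing_functional \<Psi>"
    and red: "\<And>x. x \<in> instances (TT1 k) \<Longrightarrow> \<exists>z\<in>instances RT1_N. \<Phi> x = Some z \<and>
        (\<forall>y\<in>solutions RT1_N z. \<exists>w\<in>solutions (TT1 k) x. \<Psi> (x \<oplus> y) = Some w)"
    unfolding weihrauch_le_def by blast
  define X where "X = {f :: baire. \<forall>n. f n < k}"
  define G where "G f = the (\<Phi> f)" for f
  \<comment> \<open>This decodes the characteristic function returned by \<open>\<Psi>\<close>;
    \<open>sol\<close> shows that \<open>the\<close> is applied to a genuine value when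
    \<open>f\<close> is in \<open>X\<close> and \<open>M\<close> is homogeneous.\<close>
  define S where "S f M = {\<sigma>. the (\<Psi> (f \<oplus> char_fun M)) (str_code \<sigma>) = 1}" for f M
  define hom where "hom f M \<longleftrightarrow> infinite M \<and> (\<exists>c. \<forall>m\<in>M. G f m = c)" for f M
  have X: "f \<in> instances (TT1 k)" if "f \<in> X" for f
    using that by (simp add: X_def TT1_def)
  have \<Phi>: "\<Phi> f = Some (G f)" and finite: "finite (range (G f))" if "f \<in> X" for f
    using red[OF X[OF that]] by (auto simp: G_def RT1_N_def)
  have sol: "\<Psi> (f \<oplus> char_fun M) = Some (char_fun (str_code ` S f M)) \<and> tree_copy (S f M) \<and>
      (\<exists>c. \<forall>\<sigma>\<in>S f M. f (str_code \<sigma>) = c)" if f: "f \<in> X" and M: "hom f M" for f M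
  proof -
    have "char_fun M \<in> solutions RT1_N (G f)" using M by (auto simp: RT1_N_def hom_def)
    then obtain w where w: "w \<in> solutions (TT1 k) f" "\<Psi> (f \<oplus> char_fun M) = Some w"
      using red[OF X[OF f]] \<Phi>[OF f] by auto
    then obtain H where H: "w = char_fun (str_code ` H)" "tree_copy H"
      "\<exists>c. \<forall>\<sigma>\<in>H. f (str_code \<sigma>) = c" by (auto simp: TT1_def)
    have "S f M = H"
      using bij_str_code by (auto simp: S_def w H(1) char_fun_def bij_def dest: injD split: if_splits)
    with w H show ?thesis by simp
  qed
  interpret continuous_reduction k G S X hom
  proof (unfold_locales; (fold X_def hom_def)?)
    fix f :: baire and m assume f: "f \<in> X"
    from turing_functional_continuous[OF tf(1), OF \<Phi>[OF f], where m = m]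
    obtain n where n: "\<forall>x' y'. agree n f x' \<longrightarrow> \<Phi> x' = Some y' \<longrightarrow> agree m (G f) y'"
      by blast
    have "agree m (G f) (G f')" if "f' \<in> X" "agree n f f'" for f'
      by (rule n[THEN spec, THEN spec, THEN mp, THEN mp, OF that(2) \<Phi>[OF that(1)]])
    then show "\<exists>n. \<forall>f'\<in>X. agree n f f' \<longrightarrow> agree m (G f) (G f')" by blast
  next
    fix f :: baire and M \<sigma> assume f: "f \<in> X" "hom f M" "\<sigma> \<in> S f M"
    \<comment> \<open>Agreement is strict, so the successor is taken to include the position of
      \<open>\<sigma>\<close> itself.\<close>
    from turing_functional_continuous[OF tf(2), OF conjunct1[OF sol[OF f(1,2)]], where m = "Suc (str_code \<sigma>)"]
    obtain n where n: "\<forall>x' y'. agree n (f \<oplus> char_fun M) x' \<longrightarrow> \<Psi> x' = Some y' \<longrightarrow>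
        agree (Suc (str_code \<sigma>)) (char_fun (str_code ` S f M)) y'"
      by blast
    have "\<sigma> \<in> S f' M'" if "f' \<in> X" "agree n f f'" "hom f' M'" "M \<inter> {..<n} = M' \<inter> {..<n}" for f' M'
    proof -
      have "agree n (char_fun M) (char_fun M')"
        using that(4) by (auto simp: char_fun_def set_eq_iff)
      then have "agree n (f \<oplus> char_fun M) (f' \<oplus> char_fun M')" using that(2) by (intro agree_join)
      from n[THEN spec, THEN spec, THEN mp, THEN mp, OF this conjunct1[OF sol[OF that(1,3)]]]
      have "char_fun (str_code ` S f M) (str_code \<sigma>) = char_fun (str_code ` S f' M') (str_code \<sigma>)"
        by simp
      then have "str_code \<sigma> \<in> str_code ` S f' M'"
        using f(3) by (auto simp: char_fun_def split: if_splits)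
      then show ?thesis using bij_str_code by (auto simp: bij_def dest: injD)
    qed
    then show "\<exists>n. \<forall>f'\<in>X. \<forall>M'. agree n f f' \<longrightarrow> hom f' M' \<longrightarrow>
        M \<inter> {..<n} = M' \<inter> {..<n} \<longrightarrow> \<sigma> \<in> S f' M'" by blast
  qed (use assms finite sol X_def hom_def in auto)
  show False by (rule inconsistent)
qed

end
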